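(* Let $a,b$ be nonzero real numbers, let $(\mathcal{F}_n(a,b))$ be the bi-periodic Fibonacci matrix sequence and $(\mathcal{L}_n(a,b))$ the bi-periodic Lucas matrix sequence. Then for every $n\in\mathbb{N}$: (i) $\displaystyle \mathcal{L}_0(a,b)\mathcal{F}_n(a,b)=\left(\frac{b}{a}\right)^{\varepsilon(n)}\mathcal{L}_n(a,b)=\left(\frac{a}{b}\right)^{\varepsilon(n+1)}\left(\mathcal{F}_{n-1}(a,b)+\mathcal{F}_{n+1}(a,b)\right)$; (ii) $\displaystyle \mathcal{F}_n(a,b)\mathcal{L}_0(a,b)=\mathcal{L}_0(a,b)\mathcal{F}_n(a,b)=\left(\frac{b}{a}\right)^{\varepsilon(n)}\mathcal{L}_n(a,b)$; (iii) $\displaystyle \mathcal{F}_1(a,b)\mathcal{L}_n(a,b)=\left(\frac{a}{b}\right)^{\varepsilon(n)}\left(\mathcal{F}_{n+2}(a,b)+\mathcal{F}_n(a,b)\right)=\left(\frac{b}{a}\right)^{\varepsilon(n+1)}\mathcal{L}_{n+1}(a,b)$; (iv) $\displaystyle \mathcal{L}_n(a,b)\mathcal{F}_1(a,b)=\mathcal{F}_1(a,b)\mathcal{L}_n(a,b)=\left(\frac{b}{a}\right)^{\varepsilon(n+1)}\mathcal{L}_{n+1}(a,b)$.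
   Context: Let $a,b$ be nonzero real numbers and $\mathbb{N}=\{0,1,2,\dots\}$. Put $\varepsilon(n)=1$ if $n$ is odd and $\varepsilon(n)=0$ if $n$ is even. The bi-periodic Fibonacci numbers are defined by $q_0=0$, $q_1=1$, and $q_n=a\,q_{n-1}+q_{n-2}$ if $n$ is even, $q_n=b\,q_{n-1}+q_{n-2}$ if $n$ is odd. The recurrence is run backwards to give $q_{-1}=1$, $q_{-2}=-a$. The bi-periodic Fibonacci matrix sequence is, for $n\ge -1$, $$\mathcal{F}_n(a,b)=\begin{pmatrix} \left(\frac{b}{a}\right)^{\varepsilon(n)} q_{n+1} & \frac{b}{a}\,q_n\\ q_n & \left(\frac{b}{a}\right)^{\varepsilon(n)} q_{n-1}\end{pmatrix}.$$ The bi-periodic Lucas matrix sequence is defined by $$\mathcal{L}_0(a,b)=\begin{pmatrix} a & 2\\ 2\frac{a}{b} & -a\end{pmatrix},\qquad \mathcal{L}_1(a,b)=\begin{pmatrix} a^2+2\frac{a}{b} & a\\ \frac{a^2}{b} & 2\frac{a}{b}\end{pmatrix},$$ and for $n\ge 2$, $\mathcal{L}_n(a,b)=a\,\mathcal{L}_{n-1}(a,b)+\mathcal{L}_{n-2}(a,b)$ if $n$ is odd, $\mathcal{L}_n(a,b)=b\,\mathcal{L}_{n-1}(a,b)+\mathcal{L}_{n-2}(a,b)$ if $n$ is even. *)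

theory Defs
  imports "HOL-Analysis.Analysis"
begin

definition eps :: "'a::semiring_parity \<Rightarrow> nat" where
  "eps n = (if odd n then 1 else 0)"

(* Bi-periodic Fibonacci numbers on all integer indices: the last branch solves the recurrence
   q (n + 2) = (if even n then a else b) * q (n + 1) + q n for q n, so that it also holds
   at negative indices. *)
function bifib :: "real \<Rightarrow> real \<Rightarrow> int \<Rightarrow> real" where
  "bifib a b n =
     (if n = 0 then 0
      else if n = 1 then 1
      else if n \<ge> 2 then (if even n then a else b) * bifib a b (n - 1) + bifib a b (n - 2)
      else bifib a b (n + 2) - (if even n then a else b) * bifib a b (n + 1))"
  by pat_completeness auto
termination
  by (relation "Wellfounded.measure (\<lambda>(a, b, n). if n \<ge> 0 then nat n else nat (2 - n))") auto

declare bifib.simps [simp del]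

lemma bifib_minus_1: "bifib a b (- 1) = 1"
  by (simp add: bifib.simps[of a b "- 1"] bifib.simps[of a b 0] bifib.simps[of a b 1])

lemma bifib_minus_2: "bifib a b (- 2) = - a"
  by (simp add: bifib.simps[of a b "- 2"] bifib.simps[of a b 0] bifib_minus_1)

(* Only used for n \<ge> -1. The inner vectors are the rows. *)
definition Fmat :: "real \<Rightarrow> real \<Rightarrow> int \<Rightarrow> real^2^2" where
  "Fmat a b n = vector
     [vector [(b / a) ^ eps n * bifib a b (n + 1), b / a * bifib a b n],
      vector [bifib a b n, (b / a) ^ eps n * bifib a b (n - 1)]]"

fun Lmat :: "real \<Rightarrow> real \<Rightarrow> nat \<Rightarrow> real^2^2" where
  "Lmat a b 0 = vector [vector [a, 2], vector [2 * (a / b), - a]]"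
| "Lmat a b (Suc 0) =
     vector [vector [a\<^sup>2 + 2 * (a / b), a], vector [a\<^sup>2 / b, 2 * (a / b)]]"
| "Lmat a b (Suc (Suc n)) =
     (if odd (Suc (Suc n)) then a else b) *\<^sub>R Lmat a b (Suc n) + Lmat a b n"

end

theory Submission
  imports Defs
begin

text \<open>The matrices \<open>F\<^sub>m\<close> satisfy \<open>F\<^sub>1 F\<^sub>m = F\<^sub>m F\<^sub>1 = (b/a)\<^sup>\<epsilon>\<^sup>(\<^sup>m\<^sup>) F\<^sub>m\<^sub>+\<^sub>1\<close> as well as a three-term recurrence,
  so that \<open>F\<^sub>-\<^sub>1 = F\<^sub>1 - b I\<close> acts on the sequence as the shift in the opposite direction.
  All claims reduce to these two shifts through \<open>L\<^sub>n = (a/b) (F\<^sub>n\<^sub>-\<^sub>1 + F\<^sub>n\<^sub>+\<^sub>1)\<close>, which holds because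
  both sides satisfy the same recurrence.\<close>

lemma eps_int [simp]: "eps (int n) = eps n"
  by (simp add: eps_def)

lemma bifib_rec:
  "bifib a b (m + 2) = (if even m then a else b) * bifib a b (m + 1) + bifib a b m"
proof (cases "m \<ge> 0")
  case True
  then show ?thesis
    by (subst bifib.simps) (simp add: algebra_simps)
next
  case False
  \<comment> \<open>For negative \<open>m\<close> the definition runs backwards, so the third
    occurrence, \<open>bifib a b m\<close>, is the one to unfold: its last branch is the recurrence
    solved for this term.\<close>
  then show ?thesis
    by (subst (3) bifib.simps) simp
qed

lemma bifib_0 [simp]: "bifib a b 0 = 0"
  by (simp add: bifib.simps)

lemma bifib_1 [simp]: "bifib a b 1 = 1"
  by (simp add: bifib.simps)

lemma bifib_2 [simp]: "bifib a b 2 = a"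
  using bifib_rec[of a b 0] by simp

lemmas matrix_2_simps = vec_eq_iff forall_2 sum_2 vector_2 matrix_matrix_mult_def

lemma Fmat_0: "Fmat a b 0 = mat 1"
  by (simp add: Fmat_def eps_def matrix_2_simps mat_def bifib_minus_1)

text \<open>One coefficient serves all four entries: off the diagonal it is that of
  \<open>bifib_rec\<close>; on the diagonal, where the parity is shifted by one, the powers of
  \<open>b / a\<close> exchange \<open>a\<close> and \<open>b\<close>.\<close>

lemma Fmat_rec:
  assumes "a \<noteq> 0"
  shows "Fmat a b (m + 1) = (if even m then b else a) *\<^sub>R Fmat a b m + Fmat a b (m - 1)"
  using assms bifib_rec[of a b m] bifib_rec[of a b "m - 1"] bifib_rec[of a b "m - 2"]
  by (auto simp: Fmat_def eps_def matrix_2_simps field_simps)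

text \<open>\<open>Fmat a b 1\<close> has rows \<open>(b, b / a)\<close> and \<open>(1, 0)\<close>,
  so it moves the first row of \<open>Fmat a b m\<close> down; the scalar fits because
  \<open>eps m + eps (m + 1) = 1\<close>.\<close>

lemma Fmat_1_mult:
  assumes "a \<noteq> 0"
  shows "Fmat a b 1 ** Fmat a b m = (b / a) ^ eps m *\<^sub>R Fmat a b (m + 1)"
  using assms bifib_rec[of a b m] bifib_rec[of a b "m - 1"]
  by (auto simp: Fmat_def eps_def matrix_2_simps field_simps)

lemma Fmat_mult_1:
  assumes "a \<noteq> 0"
  shows "Fmat a b m ** Fmat a b 1 = (b / a) ^ eps m *\<^sub>R Fmat a b (m + 1)"
  using assms bifib_rec[of a b m] bifib_rec[of a b "m - 1"]
  by (auto simp: Fmat_def eps_def matrix_2_simps field_simps)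

lemma Fmat_minus_1:
  assumes "a \<noteq> 0"
  shows "Fmat a b (- 1) = Fmat a b 1 - b *\<^sub>R mat 1"
  using Fmat_rec[OF assms, of b 0] by (simp add: Fmat_0)

text \<open>The power of \<open>b / a\<close> turns the coefficient in \<open>Fmat_rec\<close> into
  \<open>b\<close> for both parities of \<open>m\<close>.\<close>

lemma Fmat_shift_back:
  assumes "a \<noteq> 0"
  shows "(b / a) ^ eps m *\<^sub>R Fmat a b (m + 1) - b *\<^sub>R Fmat a b m
    = (b / a) ^ eps m *\<^sub>R Fmat a b (m - 1)"
  using assms by (auto simp: Fmat_rec eps_def scaleR_add_right)

lemmas matrix_scaleR_simps = matrix_scalar_ac scalar_matrix_assoc[symmetric]

lemma matrix_add_rdistrib: "(A + B) ** C = A ** C + B ** C"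
  by (simp add: vec_eq_iff matrix_matrix_mult_def distrib_right sum.distrib)

lemma matrix_mult_diff_left: "(A - B) ** C = A ** C - B ** C" for A :: "'a::ring_1^'n^'m"
  by (simp add: vec_eq_iff matrix_matrix_mult_def left_diff_distrib sum_subtractf)

lemma matrix_mult_diff_right: "A ** (B - C) = A ** B - A ** C" for A :: "'a::ring_1^'n^'m"
  by (simp add: vec_eq_iff matrix_matrix_mult_def right_diff_distrib sum_subtractf)

lemma Fmat_minus_1_mult:
  assumes "a \<noteq> 0"
  shows "Fmat a b (- 1) ** Fmat a b m = (b / a) ^ eps m *\<^sub>R Fmat a b (m - 1)"
  using assms
  by (simp add: Fmat_minus_1 matrix_mult_diff_left matrix_scaleR_simps Fmat_1_mult Fmat_shift_back)

lemma Fmat_mult_minus_1: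
  assumes "a \<noteq> 0"
  shows "Fmat a b m ** Fmat a b (- 1) = (b / a) ^ eps m *\<^sub>R Fmat a b (m - 1)"
  using assms
  by (simp add: Fmat_minus_1 matrix_mult_diff_right matrix_scaleR_simps Fmat_mult_1 Fmat_shift_back)

lemma Lmat_eq_Fmat:
  assumes "a \<noteq> 0" "b \<noteq> 0"
  shows "Lmat a b n = (a / b) *\<^sub>R (Fmat a b (int n - 1) + Fmat a b (int n + 1))"
  using assms
proof (induction a b n rule: Lmat.induct)
  case (1 a b)
  then show ?case
    by (simp add: Fmat_def eps_def matrix_2_simps bifib_minus_2 bifib_minus_1 field_simps)
next
  case (2 a b)
  then show ?case
    using bifib_rec[of a b 1]
    by (simp add: Fmat_def eps_def matrix_2_simps bifib_minus_1 field_simps power2_eq_square)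
next
  case (3 a b n)
  let ?c = "if odd n then a else b"
  \<comment> \<open>\<open>n\<close> and \<open>n + 2\<close> have the same parity, so both
    instances carry the coefficient with which \<open>Lmat\<close> reaches index
    \<open>n + 2\<close>.\<close>
  have "Fmat a b (int n + 1) = ?c *\<^sub>R Fmat a b (int n) + Fmat a b (int n - 1)"
    "Fmat a b (int n + 3) = ?c *\<^sub>R Fmat a b (int n + 2) + Fmat a b (int n + 1)"
    using Fmat_rec[OF 3(3), of b "int n"] Fmat_rec[OF 3(3), of b "int n + 2"]
    by (simp_all add: algebra_simps)
  with 3 show ?case
    by (simp add: algebra_simps)
qed

theorem theorem3p1:
  fixes a b :: real and n :: nat
  assumes "a \<noteq> 0" and "b \<noteq> 0"
  shows
    "(Lmat a b 0 ** Fmat a b (int n) = (b / a) ^ eps n *\<^sub>R Lmat a b n \<and>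
      (b / a) ^ eps n *\<^sub>R Lmat a b n =
        (a / b) ^ eps (n + 1) *\<^sub>R (Fmat a b (int n - 1) + Fmat a b (int n + 1))) \<and>
     (Fmat a b (int n) ** Lmat a b 0 = Lmat a b 0 ** Fmat a b (int n) \<and>
      Lmat a b 0 ** Fmat a b (int n) = (b / a) ^ eps n *\<^sub>R Lmat a b n) \<and>
     (Fmat a b 1 ** Lmat a b n =
        (a / b) ^ eps n *\<^sub>R (Fmat a b (int n + 2) + Fmat a b (int n)) \<and>
      (a / b) ^ eps n *\<^sub>R (Fmat a b (int n + 2) + Fmat a b (int n)) =
        (b / a) ^ eps (n + 1) *\<^sub>R Lmat a b (n + 1)) \<and>
     (Lmat a b n ** Fmat a b 1 = Fmat a b 1 ** Lmat a b n \<and>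
      Fmat a b 1 ** Lmat a b n = (b / a) ^ eps (n + 1) *\<^sub>R Lmat a b (n + 1))"
proof -
  have L: "Lmat a b k = (a / b) *\<^sub>R (Fmat a b (int k - 1) + Fmat a b (int k + 1))" for k
    using assms by (rule Lmat_eq_Fmat)
  \<comment> \<open>\<open>Lmat a b 0\<close> must stay folded for \<open>L\<close> to split it into
    \<open>Fmat a b (- 1)\<close> and \<open>Fmat a b 1\<close>; these shift with the same scalar,
    on either side.\<close>
  have L0F: "Lmat a b 0 ** Fmat a b (int n) = (b / a) ^ eps n *\<^sub>R Lmat a b n"
    and FL0: "Fmat a b (int n) ** Lmat a b 0 = (b / a) ^ eps n *\<^sub>R Lmat a b n"
    using assms
    by (simp_all add: L matrix_scaleR_simps matrix_add_ldistrib
        matrix_add_rdistrib Fmat_1_mult Fmat_mult_1 Fmat_minus_1_mult Fmat_mult_minus_1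
        scaleR_add_right mult.commute del: Lmat.simps)
  \<comment> \<open>Exactly one of \<open>n\<close> and \<open>n + 1\<close> is odd, so
    \<open>a / b\<close> either cancels against \<open>b / a\<close> or survives alone.\<close>
  have scal: "a / b * (b / a) ^ eps (int n - 1) = (a / b) ^ eps n"
    "a / b * (b / a) ^ eps (1 + int n) = (a / b) ^ eps n"
    "(b / a) ^ eps (n + 1) * (a / b) = (a / b) ^ eps n"
    "(b / a) ^ eps n * (a / b) = (a / b) ^ eps (n + 1)"
    using assms by (auto simp: eps_def)
  \<comment> \<open>The deleted rules would break up the products \<open>a / b * _\<close> that
    \<open>scal\<close> has to match.\<close>
  have F1L: "Fmat a b 1 ** Lmat a b n = (a / b) ^ eps n *\<^sub>R (Fmat a b (int n + 2) + Fmat a b (int n))"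
    and LF1: "Lmat a b n ** Fmat a b 1 = (a / b) ^ eps n *\<^sub>R (Fmat a b (int n + 2) + Fmat a b (int n))"
    using assms
    by (simp_all add: L matrix_scaleR_simps matrix_add_ldistrib
        matrix_add_rdistrib Fmat_1_mult Fmat_mult_1 scaleR_add_right scal add.commute add.left_commute
        del: times_divide_eq_left times_divide_eq_right)
  have "(b / a) ^ eps n *\<^sub>R Lmat a b n
      = (a / b) ^ eps (n + 1) *\<^sub>R (Fmat a b (int n - 1) + Fmat a b (int n + 1))"
    unfolding L[of n] scaleR_scaleR scal ..
  moreover have "(b / a) ^ eps (n + 1) *\<^sub>R Lmat a b (n + 1)
      = (a / b) ^ eps n *\<^sub>R (Fmat a b (int n + 2) + Fmat a b (int n))"
    unfolding L[of "n + 1"] scaleR_scaleR scal by (simp add: add.commute)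
  ultimately show ?thesis
    using L0F FL0 F1L LF1 by simp
qed

end
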